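(* Let $|\psi\rangle$ and $|\xi\rangle$ be two normalized three-qubit pure states in the GHZ class, and assume there is an LOCC protocol that transforms $|\psi\rangle$ into $|\xi\rangle$ with probability 1. Then $$\mathrm{Re}(\Omega(|\psi\rangle)) = \mathrm{Re}(\Omega(|\xi\rangle)).$$ Furthermore, $\mathrm{Re}(\Omega)$ is invariant under every local POVM in the protocol: if, at some stage of the protocol reached with nonzero probability, a local POVM is applied to the state $|\chi\rangle$ and has (normalized, nonzero-probability) outcomes $|\phi_i\rangle$, then $$\mathrm{Re}(\Omega(|\chi\rangle)) = \mathrm{Re}(\Omega(|\phi_i\rangle))\quad\text{for all } i.$$
   Context: States are unit vectors of $\mathbb{C}^2\otimes\mathbb{C}^2\otimes\mathbb{C}^2$, shared by three parties $A,B,C$ (Alice, Bob, Charlie). Two states are in the same orbit (locally unitarily equivalent) if one is mapped to the other by $U_A\otimes U_B\otimes U_C$ with $U_A,U_B,U_C\in U(2)$. GHZ class: a state is in the GHZ class if it can be written as $(g_A\otimes g_B\otimes g_C)\frac{1}{\sqrt2}(|000\rangle+|111\rangle)$ with $g_A,g_B,g_C\in GL_2(\mathbb{C})$. Equivalently, it is locally unitarily equivalent to a normalized state of the canonical form $$\mu|000\rangle+\nu e^{i\gamma}|\varphi_A\rangle|\varphi_B\rangle|\varphi_C\rangle,\qquad |\varphi_X\rangle=\cos\delta_X|0\rangle+\sin\delta_X|1\rangle,$$ with real $\mu\ge\nu>0$, $\gamma\in[0,2\pi)$, $\delta_X\in(0,\frac{\pi}{2}]$ for $X=A,B,C$. Invariant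 $\Omega$: for a state $|\psi\rangle$ in the GHZ class that is locally unitarily equivalent to the canonical form $\mu|000\rangle+\nu e^{i\gamma}|\varphi_A\rangle|\varphi_B\rangle|\varphi_C\rangle$ with $|\varphi_X\rangle=\cos\delta_X|0\rangle+\sin\delta_X|1\rangle$, $\mu\ge\nu>0$, $\gamma\in[0,2\pi)$, $\delta_X\in(0,\frac{\pi}{2}]$, $$\Omega(|\psi\rangle)=\mu\nu e^{i\gamma}\cos\delta_A\cos\delta_B\cos\delta_C,$$ i.e. the inner product of the first term with the second term of the canonical form. The canonical form is unique up to ambiguities (the sign of $\gamma$ when $\mu=\nu$; the value of $\gamma$ when some $\delta_X=\pi/2$) that do not affect $\mathrm{Re}(\Omega)$, so $\mathrm{Re}(\Omega)$ is a well-defined function on the GHZ class, constant on orbits. Local POVM: a finite family $\{A_i\}$ of $2\times2$ complex matrices with $\sum_i A_i^\dagger A_i=\mathbf{1}$, applied by one party; if Alice applies it to $|\chi\rangle$, outcome $i$ occurs with probability $q_i=\langle\chi|A_i^\dagger A_i\otimes\mathbf{1}\otimes\mathbf{1}|\chi\rangle$ and (if $q_i>0$) yields the state $q_i^{-1/2}(A_i\otimes\mathbf{1}\otimes\mathbf{1})|\chi\rangle$; similarly for Bob and Charlie. LOCC protocol: a finite sequence of steps, in each of which one of the parties applies a local unitary or a local POVM to her/his qubit, where the choice of each step may depend on all previous outcomes (classical communication). It transforms $|\psi\rangle$ into $|\xi\rangle$ with probability 1 (deterministically) if, starting from $|\psi\rangle$, every branch of outcomes occurring with nonzero probability ends in a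 state in the orbit of $|\xi\rangle$. (For such a protocol between GHZ-class states, all intermediate states occurring with nonzero probability are in the GHZ class.) *)

theory Defs
  imports "HOL-Analysis.Analysis"
begin

section \<open>Qubits and three-qubit states\<close>

text \<open>The index type \<open>2\<close> has exactly the two elements \<open>0\<close> and \<open>1\<close>
  (there \<open>2 = 0\<close>), so it labels the computational basis of a qubit.\<close>

type_synonym qubit = "complex ^ 2"
type_synonym qubit_op = "complex ^ 2 ^ 2"
type_synonym three_qubit = "complex ^ (2 \<times> 2 \<times> 2)"
type_synonym three_qubit_op = "complex ^ (2 \<times> 2 \<times> 2) ^ (2 \<times> 2 \<times> 2)"

definition ket0 :: qubit where "ket0 = axis 0 1"
definition ket1 :: qubit where "ket1 = axis 1 1"

definition tensor :: "qubit \<Rightarrow> qubit \<Rightarrow> qubit \<Rightarrow> three_qubit" where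
  "tensor a b c = (\<chi> p. a $ fst p * b $ fst (snd p) * c $ snd (snd p))"

definition tensor_op :: "qubit_op \<Rightarrow> qubit_op \<Rightarrow> qubit_op \<Rightarrow> three_qubit_op" where
  "tensor_op A B C =
     (\<chi> p q. A $ fst p $ fst q * B $ fst (snd p) $ fst (snd q) * C $ snd (snd p) $ snd (snd q))"

text \<open>\<open>(\<bullet>)\<close> on complex vectors is the real inner product; this is the Hermitian one.\<close>

definition braket :: "complex ^ 'n \<Rightarrow> complex ^ 'n \<Rightarrow> complex" where
  "braket u v = (\<Sum>i\<in>UNIV. cnj (u $ i) * v $ i)"

definition adj :: "complex ^ 'n ^ 'm \<Rightarrow> complex ^ 'm ^ 'n" where
  "adj A = (\<chi> i j. cnj (A $ j $ i))"

definition unitary :: "complex ^ 'n ^ 'n \<Rightarrow> bool" where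
  "unitary U \<longleftrightarrow> adj U ** U = mat 1 \<and> U ** adj U = mat 1"

definition lu_equiv :: "three_qubit \<Rightarrow> three_qubit \<Rightarrow> bool" where
  "lu_equiv \<psi> \<phi> \<longleftrightarrow>
     (\<exists>U\<^sub>A U\<^sub>B U\<^sub>C. unitary U\<^sub>A \<and> unitary U\<^sub>B \<and> unitary U\<^sub>C \<and> \<phi> = tensor_op U\<^sub>A U\<^sub>B U\<^sub>C *v \<psi>)"


section \<open>The GHZ class and the invariant\<close>

definition ghz_state :: three_qubit where
  "ghz_state = (1 / sqrt 2) *\<^sub>R (tensor ket0 ket0 ket0 + tensor ket1 ket1 ket1)"

definition ghz_class :: "three_qubit \<Rightarrow> bool" where
  "ghz_class \<psi> \<longleftrightarrow>
     (\<exists>g\<^sub>A g\<^sub>B g\<^sub>C. invertible g\<^sub>A \<and> invertible g\<^sub>B \<and> invertible g\<^sub>C \<and>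
        \<psi> = tensor_op g\<^sub>A g\<^sub>B g\<^sub>C *v ghz_state)"

definition tilted_ket :: "real \<Rightarrow> qubit" where
  "tilted_ket \<delta> = cos \<delta> *\<^sub>R ket0 + sin \<delta> *\<^sub>R ket1"

definition canonical_state ::
    "real \<Rightarrow> real \<Rightarrow> real \<Rightarrow> real \<Rightarrow> real \<Rightarrow> real \<Rightarrow> three_qubit" where
  "canonical_state \<mu> \<nu> \<gamma> \<delta>\<^sub>A \<delta>\<^sub>B \<delta>\<^sub>C =
     \<mu> *\<^sub>R tensor ket0 ket0 ket0
     + (of_real \<nu> * cis \<gamma>) *s tensor (tilted_ket \<delta>\<^sub>A) (tilted_ket \<delta>\<^sub>B) (tilted_ket \<delta>\<^sub>C)"

definition canonical_params ::
    "real \<Rightarrow> real \<Rightarrow> real \<Rightarrow> real \<Rightarrow> real \<Rightarrow> real \<Rightarrow> bool" where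
  "canonical_params \<mu> \<nu> \<gamma> \<delta>\<^sub>A \<delta>\<^sub>B \<delta>\<^sub>C \<longleftrightarrow>
     \<nu> \<le> \<mu> \<and> 0 < \<nu> \<and> \<gamma> \<in> {0..<2 * pi} \<and>
     \<delta>\<^sub>A \<in> {0<..pi / 2} \<and> \<delta>\<^sub>B \<in> {0<..pi / 2} \<and> \<delta>\<^sub>C \<in> {0<..pi / 2}"

definition Omega_value :: "three_qubit \<Rightarrow> complex \<Rightarrow> bool" where
  "Omega_value \<psi> z \<longleftrightarrow>
     (\<exists>\<mu> \<nu> \<gamma> \<delta>\<^sub>A \<delta>\<^sub>B \<delta>\<^sub>C. canonical_params \<mu> \<nu> \<gamma> \<delta>\<^sub>A \<delta>\<^sub>B \<delta>\<^sub>C \<and>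
        lu_equiv \<psi> (canonical_state \<mu> \<nu> \<gamma> \<delta>\<^sub>A \<delta>\<^sub>B \<delta>\<^sub>C) \<and>
        z = of_real (\<mu> * \<nu>) * cis \<gamma> * of_real (cos \<delta>\<^sub>A * cos \<delta>\<^sub>B * cos \<delta>\<^sub>C))"

text \<open>When \<open>\<mu> = \<nu>\<close> the canonical form determines \<open>\<gamma>\<close> only up to sign, so the value is
  unique only up to complex conjugation and \<open>THE\<close> would be wrong here. The real part does
  not depend on the choice. Outside the GHZ class \<open>Omega\<close> is unspecified.\<close>

definition Omega :: "three_qubit \<Rightarrow> complex" where
  "Omega \<psi> = (SOME z. Omega_value \<psi> z)"


section \<open>LOCC protocols\<close>

datatype party = Alice | Bob | Charlie

primrec local_op :: "party \<Rightarrow> qubit_op \<Rightarrow> three_qubit_op" where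
  "local_op Alice M = tensor_op M (mat 1) (mat 1)"
| "local_op Bob M = tensor_op (mat 1) M (mat 1)"
| "local_op Charlie M = tensor_op (mat 1) (mat 1) M"

definition is_povm :: "qubit_op list \<Rightarrow> bool" where
  "is_povm Ms \<longleftrightarrow> (\<Sum>M\<leftarrow>Ms. adj M ** M) = mat 1"

definition outcome_prob :: "party \<Rightarrow> qubit_op \<Rightarrow> three_qubit \<Rightarrow> real" where
  "outcome_prob X M \<eta> = Re (braket \<eta> (local_op X (adj M ** M) *v \<eta>))"

definition outcome_state :: "party \<Rightarrow> qubit_op \<Rightarrow> three_qubit \<Rightarrow> three_qubit" where
  "outcome_state X M \<eta> = (1 / sqrt (outcome_prob X M \<eta>)) *\<^sub>R (local_op X M *v \<eta>)"

text \<open>A protocol is a tree of finite depth: each outcome of a POVM carries the protocol that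
  is followed after it, so every choice may depend on all earlier outcomes. The same operator
  may occur several times in a POVM, as in an indexed family.\<close>

datatype locc =
  Stop
| Unitary party qubit_op locc
| POVM party "(qubit_op \<times> locc) list"

inductive locc_protocol :: "locc \<Rightarrow> bool" where
  "locc_protocol Stop"
| "unitary U \<Longrightarrow> locc_protocol Q \<Longrightarrow> locc_protocol (Unitary X U Q)"
| "is_povm (map fst bs) \<Longrightarrow> (\<And>M Q. (M, Q) \<in> set bs \<Longrightarrow> locc_protocol Q) \<Longrightarrow>
     locc_protocol (POVM X bs)"

text \<open>A configuration is the remaining protocol together with the current state; a step
  follows one outcome of nonzero probability. Hence \<open>locc_step\<^sup>*\<^sup>*\<close> relates the initial
  configuration to exactly the stages reached with nonzero probability.\<close>

inductive locc_step :: "locc \<times> three_qubit \<Rightarrow> locc \<times> three_qubit \<Rightarrow> bool" where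
  "locc_step (Unitary X U Q, \<eta>) (Q, local_op X U *v \<eta>)"
| "(M, Q) \<in> set bs \<Longrightarrow> outcome_prob X M \<eta> > 0 \<Longrightarrow>
     locc_step (POVM X bs, \<eta>) (Q, outcome_state X M \<eta>)"

definition transforms_deterministically :: "locc \<Rightarrow> three_qubit \<Rightarrow> three_qubit \<Rightarrow> bool" where
  "transforms_deterministically P \<psi> \<xi> \<longleftrightarrow>
     (\<forall>\<phi>. locc_step\<^sup>*\<^sup>* (P, \<psi>) (Stop, \<phi>) \<longrightarrow> lu_equiv \<xi> \<phi>)"

end

(* Write a GHZ state as t + t' with product terms t and t'. This decomposition is unique up to
   order, so Re Omega = Re <t|t'>, which can be evaluated without passing to canonical form.
   For a POVM (M_i), the completeness relation gives sum_i <M_i t|M_i t'> = <t|t'>, and the left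
   side is the average of Omega over the outcomes: Re Omega is a martingale along the protocol.
   As Re Omega takes the same value w at all leaves, it equals w at every stage by induction on
   the tree. A branch with a singular M_i never returns to the GHZ class, because the
   hyperdeterminant then vanishes for good. *)

theory Submission
  imports Defs
begin

section \<open>Coordinates, product vectors and the Hermitian inner product\<close>

lemma UNIV_bit: "(UNIV :: 2 set) = {0, 1}"
proof -
  have "(2 :: 2) = 0" by simp
  then show ?thesis using UNIV_2 by (metis insert_commute)
qed

lemma all_bit: "(\<forall>i::2. P i) \<longleftrightarrow> P 0 \<and> P 1"
  using UNIV_bit by (metis UNIV_I insertE singletonD)

lemma sum_bit: "sum f (UNIV :: 2 set) = f 0 + f 1"
  by (simp add: UNIV_bit)

lemma vec_bit_eq_iff: "(a :: 'a ^ 2) = b \<longleftrightarrow> a $ 0 = b $ 0 \<and> a $ 1 = b $ 1"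
  by (simp add: vec_eq_iff all_bit)

lemma scaleR_complex: "x *\<^sub>R (z :: complex) = of_real x * z"
  by (rule scaleR_conv_of_real)

lemma sum_three: "(\<Sum>p\<in>UNIV. f p) = (\<Sum>i\<in>UNIV. \<Sum>j\<in>UNIV. \<Sum>k\<in>UNIV. f (i, j, k))"
  by (simp add: sum.cartesian_product flip: UNIV_Times_UNIV)

lemma tensor_nth [simp]: "tensor a b c $ (i, j, k) = a $ i * b $ j * c $ k"
  by (simp add: tensor_def)

lemma three_qubit_eq_iff: "(\<psi> :: three_qubit) = \<phi> \<longleftrightarrow> (\<forall>i j k. \<psi> $ (i, j, k) = \<phi> $ (i, j, k))"
  by (simp add: vec_eq_iff)

lemma tensor_scale: "tensor (x *s a) (y *s b) (z *s c) = (x * y * z) *s tensor a b c"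
  by (simp add: three_qubit_eq_iff)

lemma tensor_op_tensor: "tensor_op A B C *v tensor a b c = tensor (A *v a) (B *v b) (C *v c)"
  by (simp add: three_qubit_eq_iff matrix_vector_mult_def sum_three tensor_op_def tensor_def sum_bit algebra_simps)

lemma tensor_op_mult: "tensor_op A B C ** tensor_op A' B' C' = tensor_op (A ** A') (B ** B') (C ** C')"
  by (simp add: vec_eq_iff matrix_matrix_mult_def sum_three tensor_op_def sum_bit algebra_simps)

lemma adj_tensor_op: "adj (tensor_op A B C) = tensor_op (adj A) (adj B) (adj C)"
  by (simp add: vec_eq_iff adj_def tensor_op_def)

lemma tensor_op_one: "tensor_op (mat 1) (mat 1) (mat 1) = mat 1"
  by (auto simp: vec_eq_iff tensor_op_def mat_def)

lemma adj_one [simp]: "adj (mat 1) = mat 1"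
  by (auto simp: vec_eq_iff adj_def mat_def)

lemma braket_adj: "braket u (adj A *v v) = braket (A *v u) v"
proof -
  have "braket u (adj A *v v) = (\<Sum>i\<in>UNIV. \<Sum>j\<in>UNIV. cnj (u $ i) * (cnj (A $ j $ i) * v $ j))"
    by (simp add: braket_def adj_def matrix_vector_mult_def sum_distrib_left)
  also have "\<dots> = (\<Sum>j\<in>UNIV. \<Sum>i\<in>UNIV. cnj (u $ i) * (cnj (A $ j $ i) * v $ j))"
    by (rule sum.swap)
  also have "\<dots> = braket (A *v u) v"
    by (simp add: braket_def matrix_vector_mult_def sum_distrib_right sum_distrib_left mult_ac)
  finally show ?thesis .
qed

lemma braket_gram: "braket u ((adj A ** A) *v v) = braket (A *v u) (A *v v)"
  by (simp add: braket_adj flip: matrix_vector_mul_assoc)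

lemma cnj_braket: "cnj (braket u v) = braket v u"
  by (simp add: braket_def mult.commute)

lemma braket_self: "braket u u = of_real ((norm u)\<^sup>2)"
  by (simp add: braket_def norm_vec_def L2_set_def sum_nonneg complex_norm_square mult.commute
      flip: of_real_power)

lemma braket_tensor: "braket (tensor a b c) (tensor a' b' c') = braket a a' * braket b b' * braket c c'"
  by (simp add: braket_def sum_three sum_bit algebra_simps)

lemma unitary_one: "unitary (mat 1)"
  by (simp add: unitary_def)

lemma unitary_tensor_op: "unitary A \<Longrightarrow> unitary B \<Longrightarrow> unitary C \<Longrightarrow> unitary (tensor_op A B C)"
  by (simp add: unitary_def adj_tensor_op tensor_op_mult tensor_op_one)

lemma unitary_braket: "unitary U \<Longrightarrow> braket (U *v u) (U *v v) = braket u v"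
  by (simp add: unitary_def flip: braket_gram)

lemma unitary_norm:
  assumes "unitary U" shows "norm (U *v u) = norm u"
proof -
  have "complex_of_real ((norm (U *v u))\<^sup>2) = of_real ((norm u)\<^sup>2)"
    using unitary_braket[OF assms, of u u] by (simp only: braket_self)
  then show ?thesis
    by (simp only: of_real_eq_iff) simp
qed

section \<open>The two product terms of a state\<close>

text \<open>The determinant of the matrix with columns \<open>a\<close> and \<open>b\<close>; it is
  nonzero exactly when they are linearly independent.\<close>

definition skew :: "qubit \<Rightarrow> qubit \<Rightarrow> complex" where
  "skew a b = a $ 0 * b $ 1 - a $ 1 * b $ 0"

text \<open>Contracting the third qubit with the functional of coefficients \<open>x\<close>,
  \<open>y\<close> leaves a 2 x 2 matrix indexed by the first two qubits; this is its
  determinant.\<close>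

definition slice_det :: "three_qubit \<Rightarrow> complex \<Rightarrow> complex \<Rightarrow> complex" where
  "slice_det \<psi> x y =
     (x * \<psi> $ (0, 0, 0) + y * \<psi> $ (0, 0, 1)) * (x * \<psi> $ (1, 1, 0) + y * \<psi> $ (1, 1, 1))
   - (x * \<psi> $ (0, 1, 0) + y * \<psi> $ (0, 1, 1)) * (x * \<psi> $ (1, 0, 0) + y * \<psi> $ (1, 0, 1))"

text \<open>Cayley's hyperdeterminant, as the discriminant of the binary quadratic form \<open>slice_det \<psi>\<close>.\<close>

definition hyperdet :: "three_qubit \<Rightarrow> complex" where
  "hyperdet \<psi> = (slice_det \<psi> 1 1 - slice_det \<psi> 1 0 - slice_det \<psi> 0 1)\<^sup>2
     - 4 * slice_det \<psi> 1 0 * slice_det \<psi> 0 1"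

text \<open>The contracted matrix is a sum of two rank-one matrices, so its determinant factors, and
  the quadratic form splits into two linear forms given by \<open>c\<close> and
  \<open>c'\<close>.\<close>

lemma slice_det_tensor_sum:
  "slice_det (tensor a b c + tensor a' b' c') x y =
     skew a a' * skew b b' * (x * c $ 0 + y * c $ 1) * (x * c' $ 0 + y * c' $ 1)"
  unfolding slice_det_def skew_def by (simp add: algebra_simps)

text \<open>The discriminant of a product of two linear forms is the square of their determinant.
  Hence it is nonzero iff the two terms have independent factors at all three parties.\<close>

lemma hyperdet_tensor_sum:
  "hyperdet (tensor a b c + tensor a' b' c') = (skew a a' * skew b b' * skew c c')\<^sup>2"
  unfolding hyperdet_def slice_det_tensor_sum
  by (simp add: skew_def[of c] power2_eq_square algebra_simps)

lemma skew_self [simp]: "skew a a = 0"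
  by (simp add: skew_def)

lemma skew_scale: "skew (x *s a) (y *s b) = x * y * skew a b"
  by (simp add: skew_def algebra_simps)

text \<open>Multiplicativity of the determinant: \<open>skew (M $ 0) (M $ 1)\<close> is the
  determinant of \<open>M\<close>, read off its rows.\<close>

lemma skew_matrix: "skew (M *v a) (M *v b) = skew (M $ 0) (M $ 1) * skew a b"
  by (simp add: skew_def matrix_vector_mult_def sum_bit algebra_simps)

section \<open>Uniqueness of the two product terms\<close>

lemma skew_zero_scale:
  assumes "skew a b = 0" "a \<noteq> 0" obtains x where "b = x *s a"
proof (cases "a $ 0 = 0")
  case True
  then have "a $ 1 \<noteq> 0" using assms by (simp add: vec_bit_eq_iff)
  with True assms have "b = (b $ 1 / a $ 1) *s a"
    by (simp add: skew_def vec_bit_eq_iff)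
  with that show ?thesis by blast
next
  case False
  with assms have "b = (b $ 0 / a $ 0) *s a"
    by (simp add: skew_def vec_bit_eq_iff field_simps)
  with that show ?thesis by blast
qed

text \<open>Contracting the third qubit with the functional \<open>skew _ c'\<close> keeps only the first term.\<close>

lemma first_term_unique:
  assumes eq: "tensor a b c + tensor a' b' c' = tensor p q r + tensor p' q' r'"
    and c: "skew c c' \<noteq> 0" and r: "skew r' c' = 0" "skew r c = 0"
  shows "tensor a b c = tensor p q r"
proof -
  have "c \<noteq> 0" using c by (auto simp: skew_def)
  moreover have "skew c r = 0" using r(2) by (simp add: skew_def algebra_simps)
  ultimately obtain x where x: "r = x *s c" using skew_zero_scale by blast
  have *: "a $ i * b $ j * skew c c' = p $ i * q $ j * (x * skew c c')" for i j
  proof -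
    have "a $ i * b $ j * c $ k + a' $ i * b' $ j * c' $ k = p $ i * q $ j * r $ k + p' $ i * q' $ j * r' $ k" for k
      using eq by (simp add: three_qubit_eq_iff)
    from this[of 0] this[of 1] r(1) show ?thesis
      unfolding x skew_def vector_smult_component by algebra
  qed
  then have "a $ i * b $ j = p $ i * q $ j * x" for i j
    using c by (metis mult.assoc mult_right_cancel)
  then show ?thesis by (simp add: three_qubit_eq_iff x mult.assoc)
qed

text \<open>Up to scaling, \<open>c\<close> and \<open>c'\<close> are determined by the zeros of the
  quadratic form \<open>slice_det\<close>, which depends on the state only. So \<open>r\<close> and
  \<open>r'\<close> span the same two lines in some order, and each order gives one
  disjunct.\<close>

lemma two_terms_unique:
  assumes eq: "tensor a b c + tensor a' b' c' = tensor p q r + tensor p' q' r'"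
    and nz: "hyperdet (tensor a b c + tensor a' b' c') \<noteq> 0"
  shows "tensor a b c = tensor p q r \<and> tensor a' b' c' = tensor p' q' r' \<or>
         tensor a b c = tensor p' q' r' \<and> tensor a' b' c' = tensor p q r"
proof -
  have c: "skew a a' \<noteq> 0" "skew b b' \<noteq> 0" "skew c c' \<noteq> 0"
    using nz by (auto simp: hyperdet_tensor_sum)
  have r: "skew p p' \<noteq> 0" "skew q q' \<noteq> 0" "skew r r' \<noteq> 0"
    using nz unfolding eq by (auto simp: hyperdet_tensor_sum)
  \<comment> \<open>At the arguments \<open>d $ 1\<close> and \<open>- d $ 0\<close> the linear form
    of \<open>c\<close> becomes \<open>skew c d\<close>, so \<open>d = c\<close> and
    \<open>d = c'\<close> are its zeros.\<close>
  have prod: "skew a a' * skew b b' * skew c d * skew c' d = skew p p' * skew q q' * skew r d * skew r' d" for d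
    using arg_cong[OF eq, of "\<lambda>\<psi>. slice_det \<psi> (d $ 1) (- d $ 0)"]
    by (simp add: slice_det_tensor_sum skew_def mult_ac)
  from prod[of c] r have 1: "skew r c = 0 \<or> skew r' c = 0" by auto
  from prod[of c'] r have 2: "skew r c' = 0 \<or> skew r' c' = 0" by auto
  have c0: "c \<noteq> 0" "c' \<noteq> 0" "r \<noteq> 0" "r' \<noteq> 0" using c r by (auto simp: skew_def)
  \<comment> \<open>Neither \<open>r\<close> nor \<open>r'\<close> can lie on both lines, which
    rules out the mixed cases.\<close>
  have no: "\<not> (skew d c = 0 \<and> skew d c' = 0)" if "d \<noteq> 0" for d
  proof
    assume "skew d c = 0 \<and> skew d c' = 0"
    with that obtain x y where "c = x *s d" "c' = y *s d" by (meson skew_zero_scale)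
    with c show False by (simp add: skew_scale)
  qed
  from 1 2 no c0 consider "skew r c = 0" "skew r' c' = 0" | "skew r' c = 0" "skew r c' = 0" by blast
  then show ?thesis
  proof cases
    case 1
    then show ?thesis using first_term_unique[OF eq c(3)] eq by auto
  next
    case 2
    have "tensor a b c + tensor a' b' c' = tensor p' q' r' + tensor p q r" using eq by (simp add: add.commute)
    from first_term_unique[OF this c(3)] 2 eq show ?thesis by auto
  qed
qed

text \<open>Exchanging the terms conjugates their inner product, so the real part survives the
  ambiguity of order.\<close>

lemma Re_braket_unique:
  assumes "tensor a b c + tensor a' b' c' = tensor p q r + tensor p' q' r'"
    and "hyperdet (tensor a b c + tensor a' b' c') \<noteq> 0"
  shows "Re (braket (tensor a b c) (tensor a' b' c')) = Re (braket (tensor p q r) (tensor p' q' r'))"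
  using two_terms_unique[OF assms] by (metis cnj_braket cnj.simps(1))

text \<open>The terms are the images of the two basis products under the invertible operators, which
  keep \<open>ket0\<close> and \<open>ket1\<close> independent.\<close>

lemma ghz_class_two_terms:
  assumes "ghz_class \<psi>"
  obtains a b c a' b' c' where "\<psi> = tensor a b c + tensor a' b' c'" "hyperdet \<psi> \<noteq> 0"
proof -
  obtain A B C where inv: "invertible A" "invertible B" "invertible C"
    and \<psi>: "\<psi> = tensor_op A B C *v ghz_state"
    using assms by (auto simp: ghz_class_def)
  have nz: "skew (M *v ket0) (M *v ket1) \<noteq> 0" if M: "invertible M" for M
  proof -
    obtain N where "N ** M = mat 1" using M by (auto simp: invertible_def)
    then have "N *v (M *v ket0) = ket0" "N *v (M *v ket1) = ket1"
      by (simp_all add: matrix_vector_mul_assoc)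
    then have "skew (N $ 0) (N $ 1) * skew (M *v ket0) (M *v ket1) = skew ket0 ket1"
      by (metis skew_matrix)
    also have "\<dots> = 1" by (simp add: skew_def ket0_def ket1_def axis_def)
    finally show ?thesis by auto
  qed
  let ?r = "complex_of_real (1 / sqrt 2)"
  \<comment> \<open>The normalization of the GHZ state is absorbed into Alice's factor.\<close>
  let ?a = "?r *s (A *v ket0)" and ?a' = "?r *s (A *v ket1)"
  have "ghz_state = ?r *s tensor ket0 ket0 ket0 + ?r *s tensor ket1 ket1 ket1"
    by (simp add: ghz_state_def vec_eq_iff scaleR_complex algebra_simps)
  note g = this
  have *: "\<psi> = tensor ?a (B *v ket0) (C *v ket0) + tensor ?a' (B *v ket1) (C *v ket1)"
    using tensor_scale[of ?r _ 1 _ 1]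
    unfolding \<psi> g by (simp add: matrix_vector_right_distrib tensor_op_tensor vector_scalar_commute)
  moreover have "hyperdet \<psi> \<noteq> 0"
    unfolding * hyperdet_tensor_sum by (simp add: skew_scale nz inv)
  ultimately show ?thesis by (rule that)
qed

section \<open>Canonical form\<close>

text \<open>Lagrange's identity. After normalization the two moduli are the cosine and sine of one
  angle.\<close>

lemma skew_braket_sq:
  "(cmod (braket a b))\<^sup>2 + (cmod (skew a b))\<^sup>2 = (norm a)\<^sup>2 * (norm b)\<^sup>2"
proof -
  have "complex_of_real ((cmod (braket a b))\<^sup>2 + (cmod (skew a b))\<^sup>2) = of_real ((norm a)\<^sup>2 * (norm b)\<^sup>2)"
    unfolding of_real_add of_real_mult complex_norm_square braket_self[symmetric]
    unfolding of_real_power[symmetric] braket_self[symmetric]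
    by (simp add: braket_def skew_def sum_bit algebra_simps)
  then show ?thesis by (simp only: of_real_eq_iff)
qed

text \<open>The unitary sends the direction of \<open>a\<close> to \<open>ket0\<close>, and a phase
  on its second row makes both coordinates of the image of \<open>b\<close> share the phase
  \<open>w\<close>. Independence of \<open>a\<close> and \<open>b\<close> keeps the angle
  positive.\<close>

lemma align_pair:
  assumes "skew a b \<noteq> 0"
  obtains U \<delta> w where "unitary U" "\<delta> \<in> {0<..pi / 2}" "cmod w = 1"
    "U *v a = of_real (norm a) *s ket0" "U *v b = (of_real (norm b) * w) *s tilted_ket \<delta>"
proof -
  have n: "norm a > 0" "norm b > 0" using assms by (auto simp: skew_def)
  define z where "z = braket a b / of_real (norm a * norm b)"
  define y where "y = skew a b / of_real (norm a * norm b)"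
  \<comment> \<open>If \<open>z = 0\<close>, any value of \<open>Arg z\<close> serves, because
    \<open>zw\<close> below then reads \<open>0 = 0\<close>.\<close>
  define w where "w = cis (Arg z)"
  define \<delta> where "\<delta> = arccos (cmod z)"
  define e where "e = w * of_real (cmod y) / y"
  have y0: "y \<noteq> 0" using assms n by (simp add: y_def)
  have zy: "(cmod z)\<^sup>2 + (cmod y)\<^sup>2 = 1"
    using skew_braket_sq[of a b] n
    by (simp add: z_def y_def norm_divide norm_mult power_divide power_mult_distrib field_simps)
  have z1: "cmod z < 1"
    using zy y0 by (smt (verit) norm_ge_zero one_le_power zero_less_norm_iff zero_less_power)
  have z2: "- 1 \<le> cmod z" by (rule order_trans[OF _ norm_ge_zero]) simp
  have \<delta>: "\<delta> \<in> {0<..pi / 2}"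
    using z1 z2 arccos_less_arccos[of "cmod z" 1] arccos_le_pi2[of "cmod z"] norm_ge_zero[of z] by (simp add: \<delta>_def)
  have cos: "cos \<delta> = cmod z" using z1 z2 unfolding \<delta>_def by (intro cos_arccos) auto
  have sin: "sin \<delta> = cmod y"
  proof -
    have "sin \<delta> = sqrt (1 - (cmod z)\<^sup>2)"
      using z1 z2 unfolding \<delta>_def by (intro sin_arccos) auto
    also have "\<dots> = cmod y" using zy by (simp add: real_sqrt_unique)
    finally show ?thesis .
  qed
  have w: "cmod w = 1" by (simp add: w_def)
  have zw: "z = w * of_real (cmod z)" using rcis_cmod_Arg[of z] by (simp add: w_def rcis_def mult.commute)
  have e: "cmod e = 1" using w y0 by (simp add: e_def norm_mult norm_divide)
  then have ee: "e * cnj e = 1" using complex_norm_square[of e] by simp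
  have ey: "e * y = w * of_real (cmod y)" using y0 by (simp add: e_def)
  define r where "r = complex_of_real (1 / norm a)"
  \<comment> \<open>The rows are the functionals \<open>braket a _\<close> and
    \<open>skew a _\<close>, scaled by \<open>r\<close>, the second one also by the phase
    \<open>e\<close>.\<close>
  define U :: qubit_op where
    "U = (\<chi> i j. if i = 0 then r * cnj (a $ j) else e * r * (if j = 0 then - a $ 1 else a $ 0))"
  have rr: "r * r * (a $ 0 * cnj (a $ 0) + a $ 1 * cnj (a $ 1)) = 1"
  proof -
    have "a $ 0 * cnj (a $ 0) + a $ 1 * cnj (a $ 1) = braket a a" by (simp add: braket_def sum_bit mult.commute)
    then show ?thesis using n by (simp add: braket_self r_def power2_eq_square)
  qed
  have cr: "cnj r = r" by (simp add: r_def)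
  have UU: "U ** adj U = mat 1"
  proof -
    have "r * cnj (a $ 0) * (r * a $ 0) + r * cnj (a $ 1) * (r * a $ 1) = 1"
      using rr by (simp add: algebra_simps)
    moreover have "e * r * a $ 0 * (cnj e * r * cnj (a $ 0)) + e * r * a $ 1 * (cnj e * r * cnj (a $ 1))
      = (e * cnj e) * (r * r * (a $ 0 * cnj (a $ 0) + a $ 1 * cnj (a $ 1)))"
      by (simp add: algebra_simps)
    ultimately show ?thesis
      unfolding ee rr by (simp add: vec_eq_iff all_bit matrix_matrix_mult_def sum_bit adj_def U_def mat_def cr)
  qed
  then have "adj U ** U = mat 1" by (simp add: matrix_left_right_inverse)
  with UU have U: "unitary U" by (simp add: unitary_def)
  have "U *v a = of_real (norm a) *s ket0"
  proof -
    have "r * braket a a = of_real (norm a)"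
      using n by (simp add: braket_self r_def power2_eq_square)
    then show ?thesis
      by (simp add: vec_bit_eq_iff matrix_vector_mult_def sum_bit U_def ket0_def axis_def braket_def algebra_simps)
  qed
  moreover have "U *v b = (of_real (norm b) * w) *s tilted_ket \<delta>"
  proof -
    have "r * braket a b = of_real (norm b) * z" "r * skew a b = of_real (norm b) * y"
      using n by (simp_all add: r_def z_def y_def)
    moreover have "(U *v b) $ 0 = r * braket a b" "(U *v b) $ 1 = e * (r * skew a b)"
      by (simp_all add: matrix_vector_mult_def sum_bit U_def braket_def skew_def algebra_simps)
    moreover have "tilted_ket \<delta> $ 0 = of_real (cmod z)" "tilted_ket \<delta> $ 1 = of_real (cmod y)"
      by (simp_all add: tilted_ket_def ket0_def ket1_def axis_def cos sin scaleR_complex)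
    ultimately show ?thesis
      by (simp add: vec_bit_eq_iff ey mult.assoc mult.left_commute[of e] flip: zw)
  qed
  ultimately show ?thesis using that U \<delta> w by blast
qed

lemma norm_tensor: "norm (tensor a b c) = norm a * norm b * norm c"
proof -
  have "complex_of_real ((norm (tensor a b c))\<^sup>2) = of_real ((norm a * norm b * norm c)\<^sup>2)"
    unfolding braket_self[symmetric] braket_tensor by (simp add: braket_self power_mult_distrib)
  then show ?thesis by (simp only: of_real_eq_iff) simp
qed

lemma canonical_state_alt:
  "canonical_state \<mu> \<nu> \<gamma> \<delta>\<^sub>A \<delta>\<^sub>B \<delta>\<^sub>C =
     tensor (of_real \<mu> *s ket0) ket0 ket0
     + tensor ((of_real \<nu> * cis \<gamma>) *s tilted_ket \<delta>\<^sub>A) (tilted_ket \<delta>\<^sub>B) (tilted_ket \<delta>\<^sub>C)"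
  by (simp add: canonical_state_def three_qubit_eq_iff scaleR_complex)

text \<open>The three pairs are aligned separately. The norms of the terms become
  \<open>\<mu>\<close> and \<open>\<nu>\<close>, and the three phases merge into
  \<open>cis \<gamma>\<close>.\<close>

lemma Omega_value_ordered:
  assumes nz: "hyperdet (tensor a b c + tensor a' b' c') \<noteq> 0"
    and le: "norm (tensor a' b' c') \<le> norm (tensor a b c)"
  shows "\<exists>z. Omega_value (tensor a b c + tensor a' b' c') z"
proof -
  have nz: "skew a a' \<noteq> 0" "skew b b' \<noteq> 0" "skew c c' \<noteq> 0"
    using nz by (auto simp: hyperdet_tensor_sum)
  from align_pair[OF nz(1)] obtain A \<delta>\<^sub>A u where
    A: "unitary A" "\<delta>\<^sub>A \<in> {0<..pi / 2}" "cmod u = 1" "A *v a = of_real (norm a) *s ket0"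
      "A *v a' = (of_real (norm a') * u) *s tilted_ket \<delta>\<^sub>A" .
  from align_pair[OF nz(2)] obtain B \<delta>\<^sub>B v where
    B: "unitary B" "\<delta>\<^sub>B \<in> {0<..pi / 2}" "cmod v = 1" "B *v b = of_real (norm b) *s ket0"
      "B *v b' = (of_real (norm b') * v) *s tilted_ket \<delta>\<^sub>B" .
  from align_pair[OF nz(3)] obtain C \<delta>\<^sub>C w where
    C: "unitary C" "\<delta>\<^sub>C \<in> {0<..pi / 2}" "cmod w = 1" "C *v c = of_real (norm c) *s ket0"
      "C *v c' = (of_real (norm c') * w) *s tilted_ket \<delta>\<^sub>C" .
  define \<gamma> where "\<gamma> = Arg2pi (u * v * w)"
  have \<gamma>: "\<gamma> \<in> {0..<2 * pi}" by (simp add: \<gamma>_def Arg2pi_ge_0 Arg2pi_lt_2pi)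
  have uvw: "u * v * w = cis \<gamma>"
    using Arg2pi_eq[of "u * v * w"] A(3) B(3) C(3) by (simp add: \<gamma>_def norm_mult cis_conv_exp)
  define \<mu> where "\<mu> = norm (tensor a b c)"
  define \<nu> where "\<nu> = norm (tensor a' b' c')"
  have "\<nu> > 0" using nz by (auto simp: \<nu>_def norm_tensor skew_def intro!: mult_pos_pos)
  then have par: "canonical_params \<mu> \<nu> \<gamma> \<delta>\<^sub>A \<delta>\<^sub>B \<delta>\<^sub>C"
    using le \<gamma> A B C by (simp add: canonical_params_def \<mu>_def \<nu>_def)
  have "tensor_op A B C *v (tensor a b c + tensor a' b' c') =
     (of_real (norm a) * of_real (norm b) * of_real (norm c)) *s tensor ket0 ket0 ket0 +
     ((of_real (norm a') * u) * (of_real (norm b') * v) * (of_real (norm c') * w))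
       *s tensor (tilted_ket \<delta>\<^sub>A) (tilted_ket \<delta>\<^sub>B) (tilted_ket \<delta>\<^sub>C)"
    by (simp only: matrix_vector_right_distrib tensor_op_tensor A(4,5) B(4,5) C(4,5) tensor_scale)
  also have "\<dots> = canonical_state \<mu> \<nu> \<gamma> \<delta>\<^sub>A \<delta>\<^sub>B \<delta>\<^sub>C"
  proof -
    have "(of_real (norm a') * u) * (of_real (norm b') * v) * (of_real (norm c') * w) = of_real \<nu> * cis \<gamma>"
      by (simp add: \<nu>_def norm_tensor mult_ac flip: uvw)
    then show ?thesis
      by (simp add: canonical_state_def \<mu>_def norm_tensor three_qubit_eq_iff scaleR_complex)
  qed
  finally have "lu_equiv (tensor a b c + tensor a' b' c') (canonical_state \<mu> \<nu> \<gamma> \<delta>\<^sub>A \<delta>\<^sub>B \<delta>\<^sub>C)"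
    unfolding lu_equiv_def using A(1) B(1) C(1) by metis
  with par show ?thesis unfolding Omega_value_def by blast
qed

lemma Omega_value_exists:
  assumes "hyperdet (tensor a b c + tensor a' b' c') \<noteq> 0"
  shows "\<exists>z. Omega_value (tensor a b c + tensor a' b' c') z"
  using Omega_value_ordered[of a b c a' b' c'] Omega_value_ordered[of a' b' c' a b c] assms
  by (metis add.commute linear)

text \<open>Local unitaries carry one decomposition to another one with the same inner product;
  uniqueness identifies it with the given decomposition up to order.\<close>

lemma lu_two_terms:
  assumes "lu_equiv (tensor a b c + tensor a' b' c') (tensor p q r + tensor p' q' r')"
    and nz: "hyperdet (tensor a b c + tensor a' b' c') \<noteq> 0"
  shows "hyperdet (tensor p q r + tensor p' q' r') \<noteq> 0 \<and>
    Re (braket (tensor p q r) (tensor p' q' r')) = Re (braket (tensor a b c) (tensor a' b' c'))"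
proof -
  obtain A B C where U: "unitary A" "unitary B" "unitary C"
    and eq: "tensor p q r + tensor p' q' r' = tensor_op A B C *v (tensor a b c + tensor a' b' c')"
    using assms(1) by (auto simp: lu_equiv_def)
  have eq': "tensor (A *v a) (B *v b) (C *v c) + tensor (A *v a') (B *v b') (C *v c')
      = tensor p q r + tensor p' q' r'"
    by (simp add: eq matrix_vector_right_distrib tensor_op_tensor)
  \<comment> \<open>A unitary attains both \<open>ket0\<close> and \<open>ket1\<close>, so its
    determinant cannot vanish.\<close>
  have s: "skew (M $ 0) (M $ 1) \<noteq> 0" if "unitary M" for M :: qubit_op
  proof
    assume "skew (M $ 0) (M $ 1) = 0"
    then have "skew (M *v (adj M *v ket0)) (M *v (adj M *v ket1)) = 0" by (simp add: skew_matrix)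
    moreover have "M *v (adj M *v x) = x" for x using that by (simp add: unitary_def matrix_vector_mul_assoc)
    ultimately show False by (simp add: skew_def ket0_def ket1_def axis_def)
  qed
  have h: "hyperdet (tensor (A *v a) (B *v b) (C *v c) + tensor (A *v a') (B *v b') (C *v c')) \<noteq> 0"
    using nz U s by (simp add: hyperdet_tensor_sum skew_matrix)
  from Re_braket_unique[OF eq' h] h[unfolded eq'] show ?thesis
    unfolding tensor_op_tensor[symmetric]
    using unitary_braket[OF unitary_tensor_op[OF U]] by simp
qed

text \<open>Whichever canonical form \<open>SOME\<close> selects, its value is exactly the inner
  product of its two terms, and \<open>lu_two_terms\<close> transports the real part back.\<close>

lemma Re_Omega:
  assumes nz: "hyperdet (tensor a b c + tensor a' b' c') \<noteq> 0"
  shows "Re (Omega (tensor a b c + tensor a' b' c')) = Re (braket (tensor a b c) (tensor a' b' c'))"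
proof -
  have "Omega_value (tensor a b c + tensor a' b' c') (Omega (tensor a b c + tensor a' b' c'))"
    unfolding Omega_def using Omega_value_exists[OF nz] by (rule someI_ex)
  then obtain \<mu> \<nu> \<gamma> \<delta>\<^sub>A \<delta>\<^sub>B \<delta>\<^sub>C where
    lu: "lu_equiv (tensor a b c + tensor a' b' c') (canonical_state \<mu> \<nu> \<gamma> \<delta>\<^sub>A \<delta>\<^sub>B \<delta>\<^sub>C)"
    and z: "Omega (tensor a b c + tensor a' b' c') =
      of_real (\<mu> * \<nu>) * cis \<gamma> * of_real (cos \<delta>\<^sub>A * cos \<delta>\<^sub>B * cos \<delta>\<^sub>C)"
    unfolding Omega_value_def by blast
  have "braket (x *s ket0) (y *s tilted_ket \<delta>) = cnj x * y * of_real (cos \<delta>)" for x y \<delta>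
    by (simp add: braket_def sum_bit ket0_def ket1_def tilted_ket_def axis_def scaleR_complex)
  from this[of _ _ \<delta>\<^sub>A] this[of 1 1]
  have "braket (tensor (of_real \<mu> *s ket0) ket0 ket0)
      (tensor ((of_real \<nu> * cis \<gamma>) *s tilted_ket \<delta>\<^sub>A) (tilted_ket \<delta>\<^sub>B) (tilted_ket \<delta>\<^sub>C))
      = Omega (tensor a b c + tensor a' b' c')"
    by (simp add: braket_tensor z)
  with lu_two_terms[OF lu[unfolded canonical_state_alt] nz] show ?thesis by simp
qed

section \<open>Local measurements\<close>

text \<open>Lets the three cases of \<open>local_op\<close> be treated as one
  \<open>tensor_op\<close>.\<close>

definition factor_op :: "party \<Rightarrow> qubit_op \<Rightarrow> party \<Rightarrow> qubit_op" where
  "factor_op X M Y = (if X = Y then M else mat 1)"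

lemma local_op_factor:
  "local_op X M = tensor_op (factor_op X M Alice) (factor_op X M Bob) (factor_op X M Charlie)"
  by (cases X) (simp_all add: factor_op_def)

lemma local_op_tensor_sum:
  "local_op X M *v (tensor a b c + tensor a' b' c') =
     tensor (factor_op X M Alice *v a) (factor_op X M Bob *v b) (factor_op X M Charlie *v c)
   + tensor (factor_op X M Alice *v a') (factor_op X M Bob *v b') (factor_op X M Charlie *v c')"
  by (simp add: local_op_factor matrix_vector_right_distrib tensor_op_tensor)

lemma unitary_local_op: "unitary U \<Longrightarrow> unitary (local_op X U)"
  by (cases X) (simp_all add: unitary_tensor_op unitary_one)

lemma local_op_gram: "local_op X (adj M ** M) = adj (local_op X M) ** local_op X M"
  by (cases X) (simp_all add: adj_tensor_op tensor_op_mult)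

lemma local_op_one: "local_op X (mat 1) = mat 1"
  by (cases X) (simp_all add: tensor_op_one)

lemma local_op_add: "local_op X (M + N) = local_op X M + local_op X N"
  by (cases X) (simp_all add: vec_eq_iff tensor_op_def algebra_simps)

lemma local_op_zero: "local_op X 0 = 0"
  by (cases X) (simp_all add: vec_eq_iff tensor_op_def)

lemma local_op_scaleR: "local_op X (r *\<^sub>R M) *v \<eta> = r *\<^sub>R (local_op X M *v \<eta>)"
  by (cases X)
    (simp_all add: vec_eq_iff tensor_op_def matrix_vector_mult_def scaleR_complex sum_distrib_left mult_ac)

lemma outcome_prob_norm: "outcome_prob X M \<eta> = (norm (local_op X M *v \<eta>))\<^sup>2"
  by (simp add: outcome_prob_def local_op_gram braket_gram braket_self flip: of_real_power)

text \<open>With the normalization moved into the operator, an outcome is visibly a sum of two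
  product vectors again.\<close>

lemma outcome_state_local_op:
  "outcome_state X M \<eta> = local_op X ((1 / sqrt (outcome_prob X M \<eta>)) *\<^sub>R M) *v \<eta>"
  by (simp add: outcome_state_def local_op_scaleR)

lemma norm_outcome_state: "outcome_prob X M \<eta> > 0 \<Longrightarrow> norm (outcome_state X M \<eta>) = 1"
  by (simp add: outcome_state_def outcome_prob_norm)

lemma sum_list_gram:
  "(\<Sum>M\<leftarrow>Ms. braket (local_op X M *v u) (local_op X M *v v)) =
     braket u (local_op X (\<Sum>M\<leftarrow>Ms. adj M ** M) *v v)"
proof (induction Ms)
  case Nil
  then show ?case by (simp add: local_op_zero braket_def)
next
  case (Cons M Ms)
  have "braket u (x + y) = braket u x + braket u y" for x y :: three_qubit
    by (simp add: braket_def algebra_simps sum.distrib)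
  with Cons show ?case
    by (simp add: local_op_add matrix_vector_mult_add_rdistrib local_op_gram braket_gram)
qed

text \<open>Polarized completeness relation: equal arguments give total probability 1, the two
  product terms give the martingale identity.\<close>

lemma povm_braket_sum:
  "is_povm Ms \<Longrightarrow> (\<Sum>M\<leftarrow>Ms. braket (local_op X M *v u) (local_op X M *v v)) = braket u v"
  by (simp add: sum_list_gram is_povm_def local_op_one)

lemma Re_sum_list: "Re (sum_list xs) = sum_list (map Re xs)"
  by (induction xs) auto

lemma povm_prob_sum:
  assumes "is_povm Ms" "norm \<eta> = 1" shows "(\<Sum>M\<leftarrow>Ms. outcome_prob X M \<eta>) = 1"
  using arg_cong[OF povm_braket_sum[OF assms(1), of X \<eta> \<eta>], of Re] assms(2)
  by (simp add: Re_sum_list o_def braket_self outcome_prob_norm flip: of_real_power)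

text \<open>An independent pair allows the second term to be contracted away. Two independent pairs
  are what a measurement by one party leaves untouched; this handles outcomes of probability
  zero.\<close>

lemma zero_tensor_sum:
  assumes eq: "tensor a b c + tensor a' b' c' = 0"
    and "skew a a' \<noteq> 0 \<and> skew b b' \<noteq> 0 \<or> skew a a' \<noteq> 0 \<and> skew c c' \<noteq> 0 \<or> skew b b' \<noteq> 0 \<and> skew c c' \<noteq> 0"
  shows "tensor a b c = 0"
proof -
  have e: "a $ i * b $ j * c $ k + a' $ i * b' $ j * c' $ k = 0" for i j k
    using eq by (simp add: three_qubit_eq_iff)
  have A: "skew a a' * b $ j * c $ k = 0" for j k
    using e[of 0 j k] e[of 1 j k] unfolding skew_def by algebra
  have B: "skew b b' * a $ i * c $ k = 0" for i k
    using e[of i 0 k] e[of i 1 k] unfolding skew_def by algebra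
  show ?thesis
    using assms(2) A B by (auto simp: three_qubit_eq_iff)
qed

lemma scaled_local_op_braket:
  "braket (local_op X (r *\<^sub>R M) *v u) (local_op X (r *\<^sub>R M) *v v) =
     of_real (r\<^sup>2) * braket (local_op X M *v u) (local_op X M *v v)"
  by (simp add: local_op_scaleR braket_def sum_distrib_left scaleR_complex power2_eq_square mult_ac)

section \<open>Descent through the protocol tree\<close>

lemma transforms_step:
  assumes "locc_step (P, \<psi>) (Q, \<phi>)" "transforms_deterministically P \<psi> \<xi>"
  shows "transforms_deterministically Q \<phi> \<xi>"
  using assms unfolding transforms_deterministically_def by (meson converse_rtranclp_into_rtranclp)

text \<open>A nonzero hyperdeterminant is part of the conclusion: it is known at the leaves and
  passes backwards, since a local operator multiplies it by a square of determinants. The terms stay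
  arbitrary so that the induction applies to their images.\<close>

lemma Re_braket_protocol:
  assumes \<xi>: "\<xi> = tensor x y z + tensor x' y' z'" "hyperdet \<xi> \<noteq> 0"
    and "locc_protocol P" "transforms_deterministically P (tensor a b c + tensor a' b' c') \<xi>"
    and "norm (tensor a b c + tensor a' b' c') = 1"
  shows "hyperdet (tensor a b c + tensor a' b' c') \<noteq> 0 \<and>
    Re (braket (tensor a b c) (tensor a' b' c')) = Re (braket (tensor x y z) (tensor x' y' z'))"
  using assms(3-)
proof (induction P arbitrary: a b c a' b' c')
  case 1
  then have "lu_equiv \<xi> (tensor a b c + tensor a' b' c')"
    by (simp add: transforms_deterministically_def)
  from lu_two_terms[OF this[unfolded \<xi>(1)] \<xi>(2)[unfolded \<xi>(1)]] show ?case .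
next
  case (2 U Q X)
  have U: "unitary (local_op X U)" using "2.hyps"(1) by (simp add: unitary_local_op)
  have t: "transforms_deterministically Q (local_op X U *v (tensor a b c + tensor a' b' c')) \<xi>"
    by (rule transforms_step[OF locc_step.intros(1) "2.prems"(1)])
  have n: "norm (local_op X U *v (tensor a b c + tensor a' b' c')) = 1"
    using "2.prems"(2) by (simp only: unitary_norm[OF U])
  have IH: "hyperdet (local_op X U *v (tensor a b c + tensor a' b' c')) \<noteq> 0 \<and>
      Re (braket (local_op X U *v tensor a b c) (local_op X U *v tensor a' b' c'))
      = Re (braket (tensor x y z) (tensor x' y' z'))"
    using "2.IH"[OF t[unfolded local_op_tensor_sum] n[unfolded local_op_tensor_sum]]
    unfolding local_op_tensor_sum unfolding local_op_factor tensor_op_tensor .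
  then show ?case
    unfolding unitary_braket[OF U] local_op_tensor_sum hyperdet_tensor_sum skew_matrix by auto
next
  case (3 bs X)
  let ?\<eta> = "tensor a b c + tensor a' b' c'"
  let ?w = "Re (braket (tensor x y z) (tensor x' y' z'))"
  \<comment> \<open>The induction hypothesis concerns the normalized outcome; undoing the factor
    \<open>?r\<^sup>2\<close> yields the weight \<open>outcome_prob\<close>.\<close>
  have pos: "hyperdet ?\<eta> \<noteq> 0 \<and>
      Re (braket (local_op X M *v tensor a b c) (local_op X M *v tensor a' b' c')) = outcome_prob X M ?\<eta> * ?w"
    if bs: "(M, Q) \<in> set bs" and q: "outcome_prob X M ?\<eta> > 0" for M Q
  proof -
    let ?r = "1 / sqrt (outcome_prob X M ?\<eta>)"
    have t: "transforms_deterministically Q (outcome_state X M ?\<eta>) \<xi>"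
      by (rule transforms_step[OF locc_step.intros(2)[OF bs q] "3.prems"(1)])
    have n: "norm (outcome_state X M ?\<eta>) = 1" by (rule norm_outcome_state[OF q])
    have IH: "hyperdet (local_op X (?r *\<^sub>R M) *v ?\<eta>) \<noteq> 0 \<and>
      Re (braket (local_op X (?r *\<^sub>R M) *v tensor a b c) (local_op X (?r *\<^sub>R M) *v tensor a' b' c')) = ?w"
      using "3.IH"[OF bs t[unfolded outcome_state_local_op local_op_tensor_sum]
          n[unfolded outcome_state_local_op local_op_tensor_sum]]
      unfolding local_op_tensor_sum unfolding local_op_factor tensor_op_tensor .
    have "hyperdet ?\<eta> \<noteq> 0"
      using conjunct1[OF IH] unfolding local_op_tensor_sum hyperdet_tensor_sum skew_matrix by auto
    moreover have "?r\<^sup>2 * Re (braket (local_op X M *v tensor a b c) (local_op X M *v tensor a' b' c')) = ?w"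
      using conjunct2[OF IH] unfolding scaled_local_op_braket by simp
    moreover have "?r\<^sup>2 = 1 / outcome_prob X M ?\<eta>" using q by (simp add: power_divide)
    ultimately show ?thesis using q by (simp add: field_simps)
  qed
  have one: "(\<Sum>M\<leftarrow>map fst bs. outcome_prob X M ?\<eta>) = 1"
    by (rule povm_prob_sum[OF "3.hyps"(1) "3.prems"(2)])
  \<comment> \<open>Probabilities sum to 1, so some branch really occurs and supplies the
    hyperdeterminant of \<open>?\<eta>\<close>.\<close>
  have "\<exists>M\<in>set (map fst bs). outcome_prob X M ?\<eta> > 0"
  proof (rule ccontr)
    assume "\<not> ?thesis"
    then have "(\<Sum>M\<leftarrow>map fst bs. outcome_prob X M ?\<eta>) \<le> 0"
      by (intro sum_list_nonpos) (auto simp: not_less)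
    with one show False by simp
  qed
  then have nz: "hyperdet ?\<eta> \<noteq> 0" using pos by auto
  then have sk: "skew a a' \<noteq> 0" "skew b b' \<noteq> 0" "skew c c' \<noteq> 0"
    by (auto simp: hyperdet_tensor_sum)
  \<comment> \<open>The completeness sum also runs over outcomes of probability zero, about which
    the induction says nothing; there the image of the first term vanishes.\<close>
  have all: "Re (braket (local_op X M *v tensor a b c) (local_op X M *v tensor a' b' c')) = outcome_prob X M ?\<eta> * ?w"
    if M: "M \<in> set (map fst bs)" for M
  proof (cases "outcome_prob X M ?\<eta> > 0")
    case True
    with M pos show ?thesis by auto
  next
    case False
    then have q: "outcome_prob X M ?\<eta> = 0" by (simp add: outcome_prob_norm)
    then have "local_op X M *v ?\<eta> = 0" by (simp add: outcome_prob_norm)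
    then have "local_op X M *v tensor a b c = 0"
      unfolding local_op_tensor_sum unfolding local_op_factor tensor_op_tensor
      by (rule zero_tensor_sum) (cases X; simp add: factor_op_def sk)
    with q show ?thesis by (simp add: braket_def)
  qed
  have "Re (braket (tensor a b c) (tensor a' b' c')) =
      Re (\<Sum>M\<leftarrow>map fst bs. braket (local_op X M *v tensor a b c) (local_op X M *v tensor a' b' c'))"
    by (simp only: povm_braket_sum[OF "3.hyps"(1)])
  also have "\<dots> = (\<Sum>M\<leftarrow>map fst bs. Re (braket (local_op X M *v tensor a b c) (local_op X M *v tensor a' b' c')))"
    by (simp only: Re_sum_list map_map o_def)
  also have "\<dots> = (\<Sum>M\<leftarrow>map fst bs. outcome_prob X M ?\<eta> * ?w)"
    using all by (intro arg_cong[of _ _ sum_list] map_cong) auto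
  also have "\<dots> = ?w"
    unfolding sum_list_mult_const one by simp
  finally show ?case using nz by simp
qed

text \<open>Invariant of a run. It asks for a two-term form instead of membership in the GHZ class,
  as any local operator, even a singular one, preserves that form.\<close>

definition locc_stage :: "three_qubit \<Rightarrow> locc \<times> three_qubit \<Rightarrow> bool" where
  "locc_stage \<xi> s \<longleftrightarrow> locc_protocol (fst s) \<and> transforms_deterministically (fst s) (snd s) \<xi> \<and>
     norm (snd s) = 1 \<and> (\<exists>a b c a' b' c'. snd s = tensor a b c + tensor a' b' c')"

lemma locc_stage_step:
  assumes "locc_step s s'" "locc_stage \<xi> s"
  shows "locc_stage \<xi> s'"
proof -
  have two: "\<exists>a b c a' b' c'. local_op X M *v \<eta> = tensor a b c + tensor a' b' c'"
    if "\<exists>a b c a' b' c'. \<eta> = tensor a b c + tensor a' b' c'" for X M \<eta>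
    using that local_op_tensor_sum by metis
  have "transforms_deterministically (fst s') (snd s') \<xi>"
    using assms transforms_step[of "fst s" "snd s" "fst s'" "snd s'"] by (simp add: locc_stage_def)
  with assms show ?thesis
  proof (induction rule: locc_step.induct)
    case (1 X U Q \<eta>)
    then have "unitary U" "locc_protocol Q" by (auto simp: locc_stage_def elim: locc_protocol.cases)
    with 1 two show ?case by (simp add: locc_stage_def unitary_norm unitary_local_op)
  next
    case (2 M Q bs X \<eta>)
    then have "locc_protocol Q" by (auto simp: locc_stage_def elim: locc_protocol.cases)
    with 2 two show ?case by (simp add: locc_stage_def norm_outcome_state) (simp add: outcome_state_local_op)
  qed
qed

lemma locc_stage_steps: "locc_step\<^sup>*\<^sup>* s s' \<Longrightarrow> locc_stage \<xi> s \<Longrightarrow> locc_stage \<xi> s'"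
  by (induction rule: rtranclp_induct) (auto intro: locc_stage_step)

text \<open>The protocol remaining at a stage is itself a deterministic transformation into
  \<open>\<xi>\<close>, so the tree induction can start there.\<close>

lemma Re_Omega_stage:
  assumes "ghz_class \<xi>" "locc_stage \<xi> (Q, \<eta>)"
  shows "Re (Omega \<eta>) = Re (Omega \<xi>)"
proof -
  obtain x y z x' y' z' where \<xi>: "\<xi> = tensor x y z + tensor x' y' z'" "hyperdet \<xi> \<noteq> 0"
    using ghz_class_two_terms[OF assms(1)] by metis
  obtain a b c a' b' c' where \<eta>: "\<eta> = tensor a b c + tensor a' b' c'"
    and "locc_protocol Q" "transforms_deterministically Q \<eta> \<xi>" "norm \<eta> = 1"
    using assms(2) by (auto simp: locc_stage_def)
  with Re_braket_protocol[OF \<xi>, of Q] show ?thesis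
    using \<xi> Re_Omega by metis
qed

theorem theorem1:
  fixes \<psi> \<xi> :: three_qubit and P :: locc
  assumes "norm \<psi> = 1" and "norm \<xi> = 1"
    and "ghz_class \<psi>" and "ghz_class \<xi>"
    and "locc_protocol P"
    and "transforms_deterministically P \<psi> \<xi>"
  shows "Re (Omega \<psi>) = Re (Omega \<xi>) \<and>
    (\<forall>X bs \<eta> M Q.
       locc_step\<^sup>*\<^sup>* (P, \<psi>) (POVM X bs, \<eta>) \<and> (M, Q) \<in> set bs \<and> outcome_prob X M \<eta> > 0 \<longrightarrow>
       Re (Omega \<eta>) = Re (Omega (outcome_state X M \<eta>)))"
proof (intro conjI allI impI)
  have start: "locc_stage \<xi> (P, \<psi>)"
    using assms ghz_class_two_terms[OF assms(3)] by (simp add: locc_stage_def) metis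
  then show "Re (Omega \<psi>) = Re (Omega \<xi>)" by (rule Re_Omega_stage[OF assms(4)])
  fix X bs \<eta> M Q
  assume *: "locc_step\<^sup>*\<^sup>* (P, \<psi>) (POVM X bs, \<eta>) \<and> (M, Q) \<in> set bs \<and> outcome_prob X M \<eta> > 0"
  then have \<eta>: "locc_stage \<xi> (POVM X bs, \<eta>)" using start locc_stage_steps by blast
  moreover have "locc_step (POVM X bs, \<eta>) (Q, outcome_state X M \<eta>)"
    using * by (blast intro: locc_step.intros)
  ultimately have "locc_stage \<xi> (Q, outcome_state X M \<eta>)" by (blast intro: locc_stage_step)
  \<comment> \<open>The states before and after the measurement are both stages, hence both have the
    value of \<open>\<xi>\<close>.\<close>
  with \<eta> show "Re (Omega \<eta>) = Re (Omega (outcome_state X M \<eta>))"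
    using Re_Omega_stage[OF assms(4)] by metis
qed

end
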